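(* Let $\delta\in(0,1]$ (violation parameter), $\beta\in(0,1]$ (risk of failure), and let $x_0\in\mathcal{S}$ be an initial state. Let $K\ge 1$ be an integer, and let $U_K^\ast\in\mathcal{U}^N$ be the optimal control and $p_K^\ast(x_0)$ the optimal value of the sampled mixed-integer linear program with $K$ scenarios; let $p^\ast(x_0)$ be the optimal value of the open-loop terminal time problem. If $$K\ \ge\ \frac{-\ln(\beta)}{2\delta^2},$$ then $$\mathbb{P}_{Z}^{x_0,U_K^\ast}\{\,p_K^\ast(x_0)-p^\ast(x_0)\ \ge\ \delta\,\}\ \le\ \beta .$$
   Context: System. Consider $x_{t+1}=Ax_t+Bu_t+w_t$ with $x_t\in\mathcal{X}=\mathbb{R}^{n_x}$, $u_t\in\mathcal{U}\subseteq\mathbb{R}^{n_u}$, and $w_t\in\mathcal{W}\subseteq\mathbb{R}^{n_x}$ i.i.d. with a probability density $\eta_w$. Over a horizon $N\ge 1$ write $X=[x_1^\top,\dots,x_N^\top]^\top$, $U=[u_0^\top,\dots,u_{N-1}^\top]^\top\in\mathcal{U}^N$, $W=[w_0^\top,\dots,w_{N-1}^\top]^\top\in\mathcal{W}^N$. Then $X=X(x_0,U,W)=G_xx_0+G_uU+G_wW$, where the $t$-th block row ($t=1,\dots,N$) reads $x_t=A^tx_0+\sum_{s=0}^{t-1}A^{t-1-s}(Bu_s+w_s)$. $\mathbb{P}_W$ is the law of $W$ (density $(\eta_w)^N$), and $\mathbb{P}_X^{x_0,U}$ is the induced law of $X$. Sets. The safe set is $\mathcal{S}=\{x: f_{\mathcal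 S}x\le h_{\mathcal S}\}$, the target set is $\mathcal{T}=\{x: f_{\mathcal T}x\le h_{\mathcal T}\}$ (polytopes), and $\mathcal{R}=\mathcal{S}^{N-1}\times\mathcal{T}=\{X\in\mathbb{R}^{Nn_x}: FX\le h\}$ with inequalities componentwise. Open-loop terminal time problem. For $x_0\in\mathcal{S}$ and $U\in\mathcal{U}^N$ let $z=1_{\mathcal{R}}(X)$, a Bernoulli random variable with law $\mathbb{P}_z^{x_0,U}$ and expectation $\mathbb{E}_z^{x_0,U}[z]=\mathbb{P}_X^{x_0,U}\{X\in\mathcal{R}\}$. Then $p^\ast(x_0)=\max_{U\in\mathcal{U}^N}\mathbb{E}_z^{x_0,U}[z]$. Sampled mixed-integer linear program. Given samples $W^{(1)},\dots,W^{(K)}$ of $W$ drawn according to $\mathbb{P}_W$, maximize $\frac1K\sum_{i=1}^K z^{(i)}$ over $U\in\mathcal{U}^N$ and $z^{(i)}\in\{0,1\}$ subject to $X^{(i)}=G_xx_0+G_uU+G_wW^{(i)}$ and $FX^{(i)}\le h+M(1-z^{(i)})\mathbf{1}$ for $i=1,\dots,K$, where $M>0$ is a sufficiently large constant, so that at the optimum $z^{(i)}=1$ if and only if $FX^{(i)}\le h$. Its optimal value is $p_K^\ast(x_0)$ and its optimal control is $U_K^\ast$. Probability convention. For a control $U\in\mathcal{U}^N$, $Z=[z^{(1)},\dots,z^{(K)}]^\top$ denotes the vector of $K$ i.i.d. Bernoulli variables, each with law $\mathbb{P}_z^{x_0,U}$; its law is by definition the product measure $\mathbb{P}_Z^{x_0,U}=\prod_{i=1}^K\mathbb{P}_z^{x_0,U}$.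 In the conclusion, $\mathbb{P}_Z^{x_0,U_K^\ast}$ is this product measure taken at the control $U=U_K^\ast$ (regarded as a given element of $\mathcal{U}^N$), and under it $p_K^\ast(x_0)$ is the random variable $\frac1K\sum_{i=1}^K z^{(i)}=\frac{\mathbf{1}^\top Z}{K}$. *)

theory Defs
  imports "HOL-Probability.Probability"
begin

text \<open>
  The horizon \<open>N\<close> is a term, so stacked vectors are kept in blocks, as extensional functions:
  \<open>X = [x_1, ..., x_N]\<close> lives on the index set \<open>{1..N}\<close>, while \<open>U = [u_0, ..., u_{N-1}]\<close> and
  \<open>W = [w_0, ..., w_{N-1}]\<close> live on \<open>{..<N}\<close>.
\<close>

primrec mpow :: "real^'n^'n \<Rightarrow> nat \<Rightarrow> real^'n^'n" where
  "mpow A 0 = mat 1"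
| "mpow A (Suc t) = A ** mpow A t"

definition traj ::
  "nat \<Rightarrow> real^'n^'n \<Rightarrow> real^'m^'n \<Rightarrow> real^'n \<Rightarrow> (nat \<Rightarrow> real^'m) \<Rightarrow> (nat \<Rightarrow> real^'n) \<Rightarrow> nat \<Rightarrow> real^'n"
where
  "traj N A B x0 U W =
     (\<lambda>t\<in>{1..N}. mpow A t *v x0 + (\<Sum>s<t. mpow A (t - 1 - s) *v (B *v U s + W s)))"

lemma traj_first:
  "1 \<le> N \<Longrightarrow> traj N A B x0 U W 1 = A *v x0 + B *v U 0 + W 0"
  by (simp add: traj_def algebra_simps)

lemma traj_step:
  assumes "1 \<le> t" "t < N"
  shows "traj N A B x0 U W (Suc t) = A *v traj N A B x0 U W t + B *v U t + W t"
proof -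
  have eq: "mpow A (t - s) = A ** mpow A (t - 1 - s)" if "s < t" for s
    using that by (metis Suc_diff_Suc diff_Suc_eq_diff_pred mpow.simps(2))
  have "(\<Sum>s<t. mpow A (t - s) *v (B *v U s + W s)) =
      A *v (\<Sum>s<t. mpow A (t - 1 - s) *v (B *v U s + W s))"
    unfolding linear_sum[OF matrix_vector_mul_linear] matrix_vector_mul_assoc
    by (intro sum.cong refl) (simp only: lessThan_iff eq matrix_vector_mul_assoc)
  with assms show ?thesis
    by (simp add: traj_def matrix_vector_mul_assoc matrix_vector_right_distrib algebra_simps)
qed

definition controls :: "nat \<Rightarrow> (real^'m) set \<Rightarrow> (nat \<Rightarrow> real^'m) set" where
  "controls N \<U> = (\<Pi>\<^sub>E t\<in>{..<N}. \<U>)"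

text \<open>The order on vectors is the componentwise one.\<close>

definition halfspaces :: "real^'n^'p \<Rightarrow> real^'p \<Rightarrow> (real^'n) set" where
  "halfspaces f h = {x. f *v x \<le> h}"

definition reach_set :: "nat \<Rightarrow> (real^'n) set \<Rightarrow> (real^'n) set \<Rightarrow> (nat \<Rightarrow> real^'n) set" where
  "reach_set N S T = (\<Pi>\<^sub>E t\<in>{1..N}. if t = N then T else S)"

text \<open>The product \<open>F X\<close>, for \<open>F = [F_1 ... F_N]\<close> split into block columns.\<close>

definition block_mult :: "nat \<Rightarrow> (nat \<Rightarrow> real^'n^'r) \<Rightarrow> (nat \<Rightarrow> real^'n) \<Rightarrow> real^'r" where
  "block_mult N F X = (\<Sum>t=1..N. F t *v X t)"

definition law_W :: "nat \<Rightarrow> (real^'n \<Rightarrow> real) \<Rightarrow> (nat \<Rightarrow> real^'n) measure" where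
  "law_W N \<eta> = (\<Pi>\<^sub>M t\<in>{..<N}. density lborel (\<lambda>w. ennreal (\<eta> w)))"

definition law_X ::
  "nat \<Rightarrow> real^'n^'n \<Rightarrow> real^'m^'n \<Rightarrow> (real^'n \<Rightarrow> real) \<Rightarrow> real^'n \<Rightarrow> (nat \<Rightarrow> real^'m) \<Rightarrow>
    (nat \<Rightarrow> real^'n) measure"
where
  "law_X N A B \<eta> x0 U = distr (law_W N \<eta>) (\<Pi>\<^sub>M t\<in>{1..N}. borel) (traj N A B x0 U)"

definition law_z ::
  "nat \<Rightarrow> real^'n^'n \<Rightarrow> real^'m^'n \<Rightarrow> (real^'n \<Rightarrow> real) \<Rightarrow> (nat \<Rightarrow> real^'n) set \<Rightarrow> real^'n \<Rightarrow>
    (nat \<Rightarrow> real^'m) \<Rightarrow> real measure"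
where
  "law_z N A B \<eta> R x0 U = distr (law_X N A B \<eta> x0 U) borel (indicator R)"

definition law_Z ::
  "nat \<Rightarrow> nat \<Rightarrow> real^'n^'n \<Rightarrow> real^'m^'n \<Rightarrow> (real^'n \<Rightarrow> real) \<Rightarrow> (nat \<Rightarrow> real^'n) set \<Rightarrow> real^'n \<Rightarrow>
    (nat \<Rightarrow> real^'m) \<Rightarrow> (nat \<Rightarrow> real) measure"
where
  "law_Z K N A B \<eta> R x0 U = (\<Pi>\<^sub>M i\<in>{1..K}. law_z N A B \<eta> R x0 U)"

text \<open>
  The optimal value of the open-loop problem is the supremum, which is the maximum whenever
  the latter exists; the set of values is bounded by 0 and 1.
\<close>

definition open_loop_value ::
  "nat \<Rightarrow> real^'n^'n \<Rightarrow> real^'m^'n \<Rightarrow> (real^'n \<Rightarrow> real) \<Rightarrow> (nat \<Rightarrow> real^'n) set \<Rightarrow> (real^'m) set \<Rightarrow>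
    real^'n \<Rightarrow> real"
where
  "open_loop_value N A B \<eta> R \<U> x0 = (SUP U\<in>controls N \<U>. (\<integral>z. z \<partial>law_z N A B \<eta> R x0 U))"

definition milp_feasible ::
  "nat \<Rightarrow> nat \<Rightarrow> real^'n^'n \<Rightarrow> real^'m^'n \<Rightarrow> (real^'m) set \<Rightarrow> (nat \<Rightarrow> real^'n^'r) \<Rightarrow> real^'r \<Rightarrow> real \<Rightarrow>
    real^'n \<Rightarrow> (nat \<Rightarrow> nat \<Rightarrow> real^'n) \<Rightarrow> (nat \<Rightarrow> real^'m) \<Rightarrow> (nat \<Rightarrow> real) \<Rightarrow> bool"
where
  "milp_feasible K N A B \<U> F h M x0 Ws U z \<longleftrightarrow>
     U \<in> controls N \<U> \<and> z \<in> (\<Pi>\<^sub>E i\<in>{1..K}. {0, 1}) \<and>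
     (\<forall>i\<in>{1..K}. block_mult N F (traj N A B x0 U (Ws i)) \<le> h + vec (M * (1 - z i)))"

definition milp_objective :: "nat \<Rightarrow> (nat \<Rightarrow> real) \<Rightarrow> real" where
  "milp_objective K z = (1 / real K) * (\<Sum>i=1..K. z i)"

definition milp_optimal ::
  "nat \<Rightarrow> nat \<Rightarrow> real^'n^'n \<Rightarrow> real^'m^'n \<Rightarrow> (real^'m) set \<Rightarrow> (nat \<Rightarrow> real^'n^'r) \<Rightarrow> real^'r \<Rightarrow> real \<Rightarrow>
    real^'n \<Rightarrow> (nat \<Rightarrow> nat \<Rightarrow> real^'n) \<Rightarrow> (nat \<Rightarrow> real^'m) \<Rightarrow> (nat \<Rightarrow> real) \<Rightarrow> bool"
where
  "milp_optimal K N A B \<U> F h M x0 Ws U z \<longleftrightarrow>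
     milp_feasible K N A B \<U> F h M x0 Ws U z \<and>
     (\<forall>U' z'. milp_feasible K N A B \<U> F h M x0 Ws U' z' \<longrightarrow>
        milp_objective K z' \<le> milp_objective K z)"

text \<open>
  The big-M requirement: at every optimum the binary variables are exactly the indicators
  of \<open>F X \<le> h\<close>.
\<close>

definition big_M_exact ::
  "nat \<Rightarrow> nat \<Rightarrow> real^'n^'n \<Rightarrow> real^'m^'n \<Rightarrow> (real^'m) set \<Rightarrow> (nat \<Rightarrow> real^'n^'r) \<Rightarrow> real^'r \<Rightarrow> real \<Rightarrow>
    real^'n \<Rightarrow> (nat \<Rightarrow> nat \<Rightarrow> real^'n) \<Rightarrow> bool"
where
  "big_M_exact K N A B \<U> F h M x0 Ws \<longleftrightarrow>
     (\<forall>U z. milp_optimal K N A B \<U> F h M x0 Ws U z \<longrightarrow>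
        (\<forall>i\<in>{1..K}. z i = 1 \<longleftrightarrow> block_mult N F (traj N A B x0 U (Ws i)) \<le> h))"

end

theory Submission
  imports Defs
begin

text \<open>
  For a fixed control the scenario variables are i.i.d. with values in \<open>{0, 1}\<close>, and their mean is
  the value that the control attains in the open-loop problem, hence at most the optimum. An empirical
  mean above the optimum by \<open>\<delta>\<close> therefore exceeds the true mean by at least \<open>\<delta>\<close>, which by Hoeffding's
  inequality has probability at most \<open>exp (- 2 * K * \<delta>\<^sup>2)\<close>.
\<close>

lemma borel_measurable_matrix_vector_mult:
  fixes A :: "real^'n^'m"
  assumes "f \<in> borel_measurable M"
  shows "(\<lambda>x. A *v f x) \<in> borel_measurable M"
  using borel_measurable_continuous_onI[OF linear_continuous_on[OF matrix_vector_mul_bounded_linear]] assms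
  by (rule measurable_compose_rev)

lemma halfspaces_borel: "halfspaces f h \<in> sets borel"
proof -
  have "(\<lambda>x. f *v x) -` {..h} \<inter> space borel \<in> sets borel"
  proof (rule measurable_sets)
    show "(*v) f \<in> borel_measurable borel"
      by (rule borel_measurable_matrix_vector_mult) simp
    show "{..h} \<in> sets borel" by (intro borel_closed closed_eucl_atMost)
  qed
  also have "(\<lambda>x. f *v x) -` {..h} \<inter> space borel = halfspaces f h"
    by (auto simp: halfspaces_def)
  finally show ?thesis .
qed

lemma reach_set_measurable:
  assumes "S \<in> sets borel" "T \<in> sets borel"
  shows "reach_set N S T \<in> sets (\<Pi>\<^sub>M t\<in>{1..N}. borel)"
  unfolding reach_set_def by (rule sets_PiM_I_finite) (use assms in auto)

lemma traj_measurable: "traj N A B x0 U \<in> measurable (law_W N \<eta>) (\<Pi>\<^sub>M t\<in>{1..N}. borel)"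
proof -
  have component: "(\<lambda>W. W s) \<in> borel_measurable (law_W N \<eta>)" if "s < N" for s
    using measurable_component_singleton[of s "{..<N}" "\<lambda>_. density lborel (\<lambda>w. ennreal (\<eta> w))"] that
    by (simp add: law_W_def)
  show ?thesis
    unfolding traj_def
  proof (rule measurable_restrict)
    fix t assume "t \<in> {1..N}"
    \<comment> \<open>Causality: only noise from before time \<open>t\<close> enters block
      \<open>t\<close>, and \<open>t \<le> N\<close>, so every index used is a coordinate of
      \<open>law_W\<close>.\<close>
    then have "s \<in> {..<t} \<Longrightarrow> s < N" for s by auto
    then show "(\<lambda>W. mpow A t *v x0 + (\<Sum>s<t. mpow A (t - 1 - s) *v (B *v U s + W s)))
        \<in> borel_measurable (law_W N \<eta>)"
      by (intro borel_measurable_add borel_measurable_sum borel_measurable_const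
          borel_measurable_matrix_vector_mult component)
  qed
qed

context
  fixes N :: nat and A :: "real^'n^'n" and B :: "real^'m^'n" and \<eta> :: "real^'n \<Rightarrow> real"
    and R :: "(nat \<Rightarrow> real^'n) set" and x0 :: "real^'n"
  assumes \<eta>_prob: "prob_space (density lborel (\<lambda>w. ennreal (\<eta> w)))"
    and R_sets: "R \<in> sets (\<Pi>\<^sub>M t\<in>{1..N}. borel)"
begin

lemma prob_space_law_X: "prob_space (law_X N A B \<eta> x0 U)"
proof -
  interpret W: prob_space "law_W N \<eta>"
    unfolding law_W_def by (rule prob_space_PiM) (rule \<eta>_prob)
  show ?thesis
    unfolding law_X_def by (rule W.prob_space_distr) (rule traj_measurable)
qed

lemma indicator_measurable_law_X: "indicator R \<in> borel_measurable (law_X N A B \<eta> x0 U)"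
  using R_sets by (intro borel_measurable_indicator) (simp add: law_X_def)

lemma prob_space_law_z: "prob_space (law_z N A B \<eta> R x0 U)"
  unfolding law_z_def
  by (rule prob_space.prob_space_distr[OF prob_space_law_X indicator_measurable_law_X])

lemma sets_law_z: "sets (law_z N A B \<eta> R x0 U) = sets borel"
  by (simp add: law_z_def)

text \<open>The law lives on all of \<open>real\<close>, so the range of the indicator survives as
  an almost sure bound, which is the form of boundedness that Hoeffding's inequality takes.\<close>

lemma AE_law_z: "AE z in law_z N A B \<eta> R x0 U. z \<in> {0..1}"
  unfolding law_z_def
  by (subst AE_distr_iff[OF indicator_measurable_law_X]) (auto simp: indicator_def)

text \<open>A real supremum dominates its members once they are bounded above; this bound, uniform
  in the control, provides that for \<open>open_loop_value\<close>.\<close>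

lemma expectation_law_z_le_1: "(\<integral>z. z \<partial>law_z N A B \<eta> R x0 U) \<le> 1"
proof -
  interpret prob_space "law_z N A B \<eta> R x0 U" by (rule prob_space_law_z)
  \<comment> \<open>Almost sure boundedness on a probability space yields the integrability that
    \<open>integral_le_const\<close> asks for.\<close>
  interpret interval_bounded_random_variable "law_z N A B \<eta> R x0 U" "\<lambda>z. z" 0 1
    by unfold_locales (use AE_law_z measurable_ident_sets[OF sets_law_z] in auto)
  show ?thesis
    by (rule integral_le_const[OF integrable]) (use AE_law_z in auto)
qed

lemma expectation_le_open_loop_value:
  assumes "U \<in> controls N \<U>"
  shows "(\<integral>z. z \<partial>law_z N A B \<eta> R x0 U) \<le> open_loop_value N A B \<eta> R \<U> x0"
  unfolding open_loop_value_def
  by (rule cSUP_upper[OF assms]) (auto intro!: bdd_aboveI2 expectation_law_z_le_1)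

end

text \<open>One-sided Hoeffding bound for an arbitrary law carried by the unit interval; the
  dynamics enter later, through the choice of \<open>P\<close>.\<close>

lemma empirical_mean_deviation:
  fixes P :: "real measure"
  assumes "prob_space P" "sets P = sets borel" "AE z in P. z \<in> {0..1}" "1 \<le> K" "0 \<le> \<delta>"
  defines "Q \<equiv> \<Pi>\<^sub>M i\<in>{1..K}. P"
  shows "measure Q {Z \<in> space Q. milp_objective K Z \<ge> (\<integral>z. z \<partial>P) + \<delta>} \<le> exp (- 2 * real K * \<delta>\<^sup>2)"
proof -
  interpret P: prob_space P by fact
  interpret Q: prob_space Q
    unfolding Q_def by (rule prob_space_PiM) (rule assms(1))
  have id: "(\<lambda>z. z) \<in> borel_measurable P"
    using assms(2) by (rule measurable_ident_sets)
  have comp: "(\<lambda>Z. Z i) \<in> measurable Q P" if "i \<in> {1..K}" for i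
    using that unfolding Q_def by (rule measurable_component_singleton)
  have rv: "(\<lambda>Z. Z i) \<in> borel_measurable Q" if "i \<in> {1..K}" for i
    using comp[OF that] measurable_cong_sets[OF refl assms(2)] by blast
  have distr: "distr Q P (\<lambda>Z. Z i) = P" if "i \<in> {1..K}" for i
    unfolding Q_def using assms(1) that by (rule distr_PiM_component)
  \<comment> \<open>Independence is checked as equality of the joint law with the product of the
    marginals; this criterion needs a nonempty index set, hence \<open>1 \<le> K\<close>.\<close>
  have "Q.indep_vars (\<lambda>_. P) (\<lambda>i Z. Z i) {1..K}"
  proof (subst Q.indep_vars_iff_distr_eq_PiM')
    \<comment> \<open>Points of the product space are extensional, so restricting them to
      \<open>{1..K}\<close> changes nothing.\<close>
    have "distr Q (\<Pi>\<^sub>M i\<in>{1..K}. P) (\<lambda>Z. \<lambda>i\<in>{1..K}. Z i) = distr Q Q (\<lambda>Z. Z)"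
      unfolding Q_def by (rule distr_cong) (auto simp: space_PiM PiE_restrict)
    also have "\<dots> = Q" by simp
    also have "\<dots> = (\<Pi>\<^sub>M i\<in>{1..K}. distr Q P (\<lambda>Z. Z i))"
      unfolding Q_def by (rule PiM_cong) (use distr in \<open>auto simp: Q_def\<close>)
    finally show "distr Q (\<Pi>\<^sub>M i\<in>{1..K}. P) (\<lambda>Z. \<lambda>i\<in>{1..K}. Z i) =
        (\<Pi>\<^sub>M i\<in>{1..K}. distr Q P (\<lambda>Z. Z i))" .
  qed (use assms(4) comp in auto)
  \<comment> \<open>Composition with the identity replaces the target \<open>P\<close> by
    \<open>borel\<close>, as the Hoeffding locale expects.\<close>
  then have indep: "Q.indep_vars (\<lambda>_. borel) (\<lambda>i Z. Z i) {1..K}"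
    using id by (rule Q.indep_vars_compose2)
  have bounds: "AE Z in Q. Z i \<in> {0..1}" if "i \<in> {1..K}" for i
    unfolding Q_def by (rule AE_PiM_component[OF assms(1) that assms(3)])
  interpret H: Hoeffding_ineq Q "{1..K}" "\<lambda>i Z. Z i" "\<lambda>_. 0" "\<lambda>_. 1"
      "\<Sum>i=1..K. Q.expectation (\<lambda>Z. Z i)"
    by unfold_locales (use indep bounds in auto)
  have mean: "Q.expectation (\<lambda>Z. Z i) = (\<integral>z. z \<partial>P)" if "i \<in> {1..K}" for i
    using integral_distr[OF comp[OF that] id] distr[OF that] by simp
  \<comment> \<open>An excess of \<delta> in the mean is an excess of \<open>K * \<delta>\<close> in
    the sum. The denominator is the sum of \<open>K\<close> squared ranges, each equal to 1.\<close>
  have "Q.prob {Z \<in> space Q. (\<Sum>i=1..K. Z i) \<ge> real K * (\<integral>z. z \<partial>P) + real K * \<delta>}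
      \<le> exp (- 2 * (real K * \<delta>)\<^sup>2 / real K)"
    using H.Hoeffding_ineq_ge[of "real K * \<delta>"] assms(4,5) by (simp add: mean)
  also have "- 2 * (real K * \<delta>)\<^sup>2 / real K = - 2 * real K * \<delta>\<^sup>2"
    using assms(4) by (simp add: power2_eq_square field_simps)
  also have "{Z \<in> space Q. (\<Sum>i=1..K. Z i) \<ge> real K * (\<integral>z. z \<partial>P) + real K * \<delta>} =
      {Z \<in> space Q. milp_objective K Z \<ge> (\<integral>z. z \<partial>P) + \<delta>}"
    using assms(4) by (auto simp: milp_objective_def field_simps)
  finally show ?thesis .
qed

theorem theorem1:
  fixes A :: "real^'n^'n" and B :: "real^'m^'n"
    and \<U> :: "(real^'m) set" and \<W> :: "(real^'n) set"
    and \<eta> :: "real^'n \<Rightarrow> real"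
    and fS :: "real^'n^'p" and hS :: "real^'p"
    and fT :: "real^'n^'q" and hT :: "real^'q"
    and S T :: "(real^'n) set" and R :: "(nat \<Rightarrow> real^'n) set"
    and F :: "nat \<Rightarrow> real^'n^'r" and h :: "real^'r"
    and N K :: nat and M \<delta> \<beta> :: real and x0 :: "real^'n"
    and Ws :: "nat \<Rightarrow> nat \<Rightarrow> real^'n"
    and UK :: "nat \<Rightarrow> real^'m" and zK :: "nat \<Rightarrow> real"
  assumes S: "S = halfspaces fS hS" and T: "T = halfspaces fT hT"
    and R: "R = reach_set N S T"
    and N: "1 \<le> N"
    and \<eta>_meas: "\<eta> \<in> borel_measurable borel" and \<eta>_nonneg: "\<And>w. 0 \<le> \<eta> w"
    and \<eta>_prob: "prob_space (density lborel (\<lambda>w. ennreal (\<eta> w)))"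
    and \<eta>_supp: "AE w in density lborel (\<lambda>w. ennreal (\<eta> w)). w \<in> \<W>"
    and R_eq: "R = {X \<in> (\<Pi>\<^sub>E t\<in>{1..N}. UNIV). block_mult N F X \<le> h}"
    and \<delta>: "0 < \<delta>" "\<delta> \<le> 1" and \<beta>: "0 < \<beta>" "\<beta> \<le> 1"
    and x0: "x0 \<in> S"
    and K: "1 \<le> K"
    and Ws: "\<And>i. i \<in> {1..K} \<Longrightarrow> Ws i \<in> (\<Pi>\<^sub>E t\<in>{..<N}. \<W>)"
    and M: "0 < M" "big_M_exact K N A B \<U> F h M x0 Ws"
    and opt: "milp_optimal K N A B \<U> F h M x0 Ws UK zK"
    and K_bound: "real K \<ge> - ln \<beta> / (2 * \<delta>\<^sup>2)"
  shows "measure (law_Z K N A B \<eta> R x0 UK)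
           {Z \<in> space (law_Z K N A B \<eta> R x0 UK).
              milp_objective K Z - open_loop_value N A B \<eta> R \<U> x0 \<ge> \<delta>} \<le> \<beta>"
proof -
  \<comment> \<open>\<open>UK\<close> is a fixed control here, so under \<open>?Q\<close> the
    scenario variables are i.i.d. by construction.\<close>
  let ?P = "law_z N A B \<eta> R x0 UK" and ?Q = "law_Z K N A B \<eta> R x0 UK"
  have R_sets: "R \<in> sets (\<Pi>\<^sub>M t\<in>{1..N}. borel)"
    unfolding R S T by (intro reach_set_measurable halfspaces_borel)
  note law_z = \<eta>_prob R_sets
  have "UK \<in> controls N \<U>"
    using opt by (simp add: milp_optimal_def milp_feasible_def)
  then have mean: "(\<integral>z. z \<partial>?P) \<le> open_loop_value N A B \<eta> R \<U> x0"
    by (rule expectation_le_open_loop_value[OF law_z])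
  interpret Q: prob_space ?Q
    unfolding law_Z_def by (rule prob_space_PiM) (rule prob_space_law_z[OF law_z])
  have [measurable]: "(\<lambda>Z. Z i) \<in> borel_measurable ?Q" if "i \<in> {1..K}" for i
    using measurable_component_singleton[OF that, of "\<lambda>_. ?P"]
      measurable_cong_sets[OF refl sets_law_z[OF law_z]]
    unfolding law_Z_def by blast
  \<comment> \<open>Monotonicity of the measure below requires the larger event to be
    measurable.\<close>
  have [measurable]: "milp_objective K \<in> borel_measurable ?Q"
    unfolding milp_objective_def by measurable
  have "Q.prob {Z \<in> space ?Q. milp_objective K Z - open_loop_value N A B \<eta> R \<U> x0 \<ge> \<delta>}
      \<le> Q.prob {Z \<in> space ?Q. milp_objective K Z \<ge> (\<integral>z. z \<partial>?P) + \<delta>}"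
    by (rule Q.finite_measure_mono) (use mean in auto)
  also have "\<dots> \<le> exp (- 2 * real K * \<delta>\<^sup>2)"
    using empirical_mean_deviation[OF prob_space_law_z[OF law_z] sets_law_z[OF law_z] AE_law_z[OF law_z]
        K less_imp_le[OF \<delta>(1)]]
    by (simp add: law_Z_def)
  \<comment> \<open>Multiplying \<open>K_bound\<close> by the positive number
    \<open>2 * \<delta>\<^sup>2\<close> bounds the exponent by \<open>ln \<beta>\<close>.\<close>
  also have "\<dots> \<le> exp (ln \<beta>)"
    using K_bound \<delta>(1) by (simp add: field_simps)
  also have "\<dots> = \<beta>" using \<beta>(1) by simp
  finally show ?thesis .
qed

end
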